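(* Let $d\ge4$ be even. For the model $\mathcal{G}_{n,d}$, the smallest order of a supercritical tangle is $\tau_{\mathrm{fund}}=\lceil(\sqrt{d-1}+1)/2\rceil-1$.
   Context: $\mathcal{G}_{n,d}$: independent uniform permutations $\pi_1,\dots,\pi_{d/2}$ of $\{1,\dots,n\}$; the graph has, for each $j,i$, a directed edge $i\to\pi_j(i)$ labelled $\pi_j$ paired with its reverse labelled $\pi_j^{-1}$ (fixed points give whole-loops). A tangle is a connected labelled graph that occurs (via a label-preserving homomorphism injective on vertices and edges) in some graph of $\mathcal{G}_{n,d}$ for some $n$. The order of a graph is (number of undirected edges) $-$ (number of vertices), each self-loop counting as one edge. For a graph $T$, $T_{\mathrm{irr}}$ is the directed graph on the directed edges of $T$ with $e_1\to e_2$ iff $e_1$ terminates at the origin of $e_2$ and $e_2$ is not the reverse of $e_1$; $\lambda_{\mathrm{irr}}(T)$ is the Perron–Frobenius eigenvalue of $T_{\mathrm{irr}}$. A tangle is supercritical if $\lambda_{\mathrm{irr}}\ge\sqrt{d-1}$. *)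

theory Defs
  imports
    "HOL-Probability.Product_PMF"
    "Graph_Theory.Graph_Theory"
    "Jordan_Normal_Form.Spectral_Radius"
begin

datatype letter = Perm nat | PermInv nat

(* arev pairs each directed edge with its reverse.  In bidirected_digraph it has no fixed point
   among the arcs, so every self-loop is a whole-loop, consisting of two directed edges. *)
record ('v, 'e) lgraph =
  dgraph :: "('v, 'e) pre_digraph"
  arev :: "'e \<Rightarrow> 'e"
  label :: "'e \<Rightarrow> letter"

abbreviation wf_lgraph :: "('v, 'e) lgraph \<Rightarrow> bool" where
  "wf_lgraph T \<equiv> bidirected_digraph (dgraph T) (arev T)"


(* The arc (Perm j, i) is i \<rightarrow> pi j i, and (PermInv j, i) is its reverse pi j i \<rightarrow> i. *)
definition perm_arcs :: "nat \<Rightarrow> nat \<Rightarrow> (letter \<times> nat) set" where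
  "perm_arcs n d = (Perm ` {1..d div 2} \<union> PermInv ` {1..d div 2}) \<times> {1..n}"

fun perm_tail :: "(nat \<Rightarrow> nat \<Rightarrow> nat) \<Rightarrow> letter \<times> nat \<Rightarrow> nat" where
  "perm_tail \<pi> (Perm j, i) = i"
| "perm_tail \<pi> (PermInv j, i) = \<pi> j i"

fun perm_head :: "(nat \<Rightarrow> nat \<Rightarrow> nat) \<Rightarrow> letter \<times> nat \<Rightarrow> nat" where
  "perm_head \<pi> (Perm j, i) = \<pi> j i"
| "perm_head \<pi> (PermInv j, i) = i"

fun flip_letter :: "letter \<Rightarrow> letter" where
  "flip_letter (Perm j) = PermInv j"
| "flip_letter (PermInv j) = Perm j"

definition perm_graph :: "nat \<Rightarrow> nat \<Rightarrow> (nat \<Rightarrow> nat \<Rightarrow> nat) \<Rightarrow> (nat, letter \<times> nat) lgraph" where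
  "perm_graph n d \<pi> =
    \<lparr> dgraph = \<lparr> verts = {1..n}, arcs = perm_arcs n d, tail = perm_tail \<pi>, head = perm_head \<pi> \<rparr>,
      arev = (\<lambda>a. if a \<in> perm_arcs n d then map_prod flip_letter id a else a),
      label = fst \<rparr>"

definition random_perm_graph :: "nat \<Rightarrow> nat \<Rightarrow> (nat, letter \<times> nat) lgraph pmf" where
  "random_perm_graph n d =
    map_pmf (perm_graph n d) (Pi_pmf {1..d div 2} id (\<lambda>_. pmf_of_set {p. p permutes {1..n}}))"

lemma wf_perm_graph:
  assumes "\<And>j. j \<in> {1..d div 2} \<Longrightarrow> \<pi> j permutes {1..n}"
  shows "wf_lgraph (perm_graph n d \<pi>)"
proof -
  have "\<pi> j i \<in> {1..n}" if "j \<in> {1..d div 2}" "i \<in> {1..n}" for i j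
    using that assms[of j] permutes_in_image[of "\<pi> j" "{1..n}" i] by blast
  thus ?thesis
    by unfold_locales (auto simp: perm_graph_def perm_arcs_def)
qed

lemma set_random_perm_graph:
  "set_pmf (random_perm_graph n d) =
    perm_graph n d ` PiE_dflt {1..d div 2} id (\<lambda>_. {p. p permutes {1..n}})"
proof -
  have "{p. p permutes {1..n}} \<noteq> {}" "finite {p. p permutes {1..n}}"
    using permutes_id by (blast, simp add: finite_permutations)
  hence "set_pmf (pmf_of_set {p. p permutes {1..n}}) = {p. p permutes {1..n}}"
    by (rule set_pmf_of_set)
  thus ?thesis
    by (simp add: random_perm_graph_def set_Pi_pmf o_def)
qed


definition lgraph_hom ::
    "('v \<Rightarrow> 'w) \<Rightarrow> ('e \<Rightarrow> 'f) \<Rightarrow> ('v, 'e) lgraph \<Rightarrow> ('w, 'f) lgraph \<Rightarrow> bool" where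
  "lgraph_hom f g T G \<longleftrightarrow>
    f ` verts (dgraph T) \<subseteq> verts (dgraph G) \<and> g ` arcs (dgraph T) \<subseteq> arcs (dgraph G) \<and>
    (\<forall>e \<in> arcs (dgraph T).
      tail (dgraph G) (g e) = f (tail (dgraph T) e) \<and>
      head (dgraph G) (g e) = f (head (dgraph T) e) \<and>
      arev G (g e) = g (arev T e) \<and>
      label G (g e) = label T e)"

definition occurs_in :: "('v, 'e) lgraph \<Rightarrow> ('w, 'f) lgraph \<Rightarrow> bool" where
  "occurs_in T G \<longleftrightarrow>
    (\<exists>f g. lgraph_hom f g T G \<and> inj_on f (verts (dgraph T)) \<and> inj_on g (arcs (dgraph T)))"

(* The library's connectedness includes that there is at least one vertex. *)
definition tangle :: "nat \<Rightarrow> ('v, 'e) lgraph \<Rightarrow> bool" where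
  "tangle d T \<longleftrightarrow>
    wf_lgraph T \<and> Digraph_Component.connected (dgraph T) \<and>
    (\<exists>n. \<exists>G \<in> set_pmf (random_perm_graph n d). occurs_in T G)"

definition undirected_edges :: "('v, 'e) lgraph \<Rightarrow> 'e set set" where
  "undirected_edges T = (\<lambda>e. {e, arev T e}) ` arcs (dgraph T)"

definition graph_order :: "('v, 'e) lgraph \<Rightarrow> int" where
  "graph_order T = int (card (undirected_edges T)) - int (card (verts (dgraph T)))"


definition irr_graph :: "('v, 'e) lgraph \<Rightarrow> 'e pair_pre_digraph" where
  "irr_graph T =
    \<lparr> pverts = arcs (dgraph T),
      parcs = {(e1, e2). e1 \<in> arcs (dgraph T) \<and> e2 \<in> arcs (dgraph T) \<and>
        head (dgraph T) e1 = tail (dgraph T) e2 \<and> e2 \<noteq> arev T e1} \<rparr>"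

(* The choice of enumeration changes the matrix only by a simultaneous permutation of rows and
   columns, hence not its spectrum.  The vertex set is meant to be finite. *)
definition adjacency_matrix :: "'a pair_pre_digraph \<Rightarrow> complex mat" where
  "adjacency_matrix D =
    (let vs = (SOME vs. distinct vs \<and> set vs = pverts D)
     in mat (length vs) (length vs) (\<lambda>(i, j). of_bool ((vs ! i, vs ! j) \<in> parcs D)))"

(* The Perron-Frobenius eigenvalue of a nonnegative matrix is its spectral radius.  The spectral
   radius of the library is unspecified for the 0 by 0 matrix (a graph without edges), where
   the value 0 is used. *)
definition lambda_irr :: "('v, 'e) lgraph \<Rightarrow> real" where
  "lambda_irr T =
    (if arcs (dgraph T) = {} then 0 else spectral_radius (adjacency_matrix (irr_graph T)))"

definition supercritical_tangle :: "nat \<Rightarrow> ('v, 'e) lgraph \<Rightarrow> bool" where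
  "supercritical_tangle d T \<longleftrightarrow> tangle d T \<and> lambda_irr T \<ge> sqrt (real d - 1)"

definition tau_fund :: "nat \<Rightarrow> int" where
  "tau_fund d = \<lceil>(sqrt (real d - 1) + 1) / 2\<rceil> - 1"

end

theory Submission imports Defs
begin

text \<open>
  If every vertex has degree at least 2, the degree excesses over 2 add up to twice the order, so
  no vertex has more than \<open>2 * order + 2\<close> outgoing edges. The row sums of the non-backtracking
  matrix are then at most \<open>2 * order + 1\<close>, which bounds the spectral radius. Deleting a leaf keeps
  the order and the nonzero eigenvalues, so the bound holds for all connected graphs with
  nonzero spectral radius. The bouquet of \<open>m\<close> whole-loops has order \<open>m - 1\<close> and all row sums
  equal to \<open>2 * m - 1\<close>, so the bound is attained.
\<close>

section \<open>Eigenvalues of the non-backtracking relation on a finite connected graph\<close>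

text \<open>Connectedness is encoded by the absence of proper nonempty vertex sets that no arc leaves.\<close>
lemma nonbacktracking_eigenvalue_le:
  fixes A :: "'e set" and V :: "'v set" and s t :: "'e \<Rightarrow> 'v" and x :: "'e \<Rightarrow> complex"
  assumes "finite A" "finite V"
    and "\<And>a. a \<in> A \<Longrightarrow> r a \<in> A \<and> r (r a) = a \<and> r a \<noteq> a \<and> s (r a) = t a \<and> s a \<in> V"
    and "\<And>U. \<lbrakk>U \<subseteq> V; U \<noteq> {}; \<And>a. \<lbrakk>a \<in> A; s a \<in> U\<rbrakk> \<Longrightarrow> t a \<in> U\<rbrakk> \<Longrightarrow> U = V"
    and "\<And>a. a \<in> A \<Longrightarrow> \<mu> * x a = (\<Sum>b | b \<in> A \<and> s b = t a \<and> b \<noteq> r a. x b)"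
    and "\<mu> \<noteq> 0" and "\<exists>a\<in>A. x a \<noteq> 0"
  shows "cmod \<mu> \<le> real (card A) - 2 * real (card V) + 1"
  using assms
\<comment> \<open>Only \<open>A\<close> and \<open>V\<close> vary: deleting a leaf restricts the
  same \<open>x\<close> to fewer arcs and keeps \<open>r\<close>, \<open>s\<close>, \<open>t\<close>
  and \<open>\<mu>\<close>.\<close>
proof (induction "card V" arbitrary: A V rule: less_induct)
  case less
  note fin = less.prems(1,2) and rev = less.prems(3) and conn = less.prems(4)
    and eig = less.prems(5) and mu = less.prems(6)
  obtain a1 where a1: "a1 \<in> A" "x a1 \<noteq> 0"
    using less.prems(7) by blast
  have src: "s a \<in> V" "t a \<in> V" if "a \<in> A" for a
    using rev[OF that] rev[of "r a"] by auto
  have tr: "t (r a) = s a" if "a \<in> A" for a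
    using rev[OF that] rev[of "r a"] by auto
  define dg where "dg v = card {a \<in> A. s a = v}" for v
  show ?case
  proof (cases "\<exists>v\<in>V. dg v < 2")
    case False
    hence dg2: "dg v \<ge> 2" if "v \<in> V" for v
      using that by force
    have total: "card A = (\<Sum>v\<in>V. dg v)"
    proof -
      have "A = (\<Union>v\<in>V. {a \<in> A. s a = v})"
        using src by auto
      hence "card A = card (\<Union>v\<in>V. {a \<in> A. s a = v})"
        by (rule arg_cong)
      also have "\<dots> = (\<Sum>v\<in>V. dg v)"
        unfolding dg_def using fin by (intro card_UN_disjoint) auto
      finally show ?thesis .
    qed
    \<comment> \<open>The out-degrees add up to \<open>card A\<close>, and each of the other
      \<open>card V - 1\<close> vertices takes at least 2 of them.\<close>
    have dg_le: "dg w + 2 * card V \<le> card A + 2" if w: "w \<in> V" for w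
    proof -
      have "card V = Suc (card (V - {w}))"
        using card_Suc_Diff1[OF fin(2) w] ..
      moreover have "2 * card (V - {w}) \<le> (\<Sum>v\<in>V - {w}. dg v)"
        using sum_bounded_below[of "V - {w}" 2 dg] dg2 by (simp add: mult.commute)
      moreover have "card A = dg w + (\<Sum>v\<in>V - {w}. dg v)"
        unfolding total using fin(2) w by (rule sum.remove)
      ultimately show ?thesis
        by linarith
    qed
    \<comment> \<open>The eigenvalue equation at an arc where \<open>cmod (x a)\<close> is largest
      bounds \<open>cmod \<mu>\<close> by the number of successors of that arc.\<close>
    define M where "M = Max ((\<lambda>a. cmod (x a)) ` A)"
    have "M \<in> (\<lambda>a. cmod (x a)) ` A"
      unfolding M_def using fin a1 by (intro Max_in) auto
    then obtain a where a: "a \<in> A" "cmod (x a) = M"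
      by auto
    have le_M: "cmod (x b) \<le> M" if "b \<in> A" for b
      unfolding M_def using fin that by (intro Max_ge) auto
    have M_pos: "M > 0"
      using le_M[OF a1(1)] a1(2) by (smt (verit) zero_less_norm_iff)
    let ?S = "{b. b \<in> A \<and> s b = t a \<and> b \<noteq> r a}"
    \<comment> \<open>The reverse of \<open>a\<close> leaves \<open>t a\<close> but is not a
      successor of \<open>a\<close>. This one missing arc turns the \<open>+ 2\<close> in
      \<open>dg_le\<close> into the \<open>+ 1\<close> of the claim.\<close>
    have "dg (t a) = card (insert (r a) ?S)"
      unfolding dg_def using rev[OF a(1)] by (intro arg_cong[where f = card]) auto
    hence card_S: "dg (t a) = Suc (card ?S)"
      using fin by simp
    have "cmod \<mu> * M = cmod (\<Sum>b\<in>?S. x b)"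
      using eig[OF a(1)] a(2) by (metis norm_mult)
    also have "\<dots> \<le> (\<Sum>b\<in>?S. cmod (x b))"
      by (rule norm_sum)
    also have "\<dots> \<le> real (card ?S) * M"
      by (intro sum_bounded_above) (use le_M in auto)
    finally have "cmod \<mu> \<le> real (card ?S)"
      using M_pos by simp
    thus ?thesis
      using dg_le[OF src(2)[OF a(1)]] card_S by linarith
  next
    case True
    then obtain v where v: "v \<in> V" "dg v < 2"
      by blast
    \<comment> \<open>An isolated vertex is a closed set and hence all of \<open>V\<close>, which
      leaves no source for the arc \<open>a1\<close>. So \<open>v\<close> has exactly one outgoing
      arc and is a leaf.\<close>
    have "dg v \<noteq> 0"
    proof
      assume "dg v = 0"
      hence none: "s a \<noteq> v" if "a \<in> A" for a
        using fin that unfolding dg_def by auto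
      have "{v} = V"
        by (rule conn) (use v none in auto)
      thus False
        using src(1)[OF a1(1)] none[OF a1(1)] by auto
    qed
    hence "card {a \<in> A. s a = v} = 1"
      using v(2) unfolding dg_def by linarith
    then obtain e where e_eq: "{a \<in> A. s a = v} = {e}"
      by (auto simp: card_1_singleton_iff)
    hence e: "e \<in> A" "s e = v" and uniq: "\<And>a. a \<in> A \<Longrightarrow> s a = v \<Longrightarrow> a = e"
      by auto
    note re = rev[OF e(1)]
    have uniq_t: "a = r e" if "a \<in> A" "t a = v" for a
      using uniq[of "r a"] rev[OF that(1)] that by auto
    let ?A = "A - {e, r e}" and ?V = "V - {v}"
    have rev_in: "r a \<in> ?A" if "a \<in> ?A" for a
      using that rev[of a] re by (metis Diff_iff insert_iff empty_iff)
    \<comment> \<open>The arc into the leaf has no successor and the arc out of it no predecessor, so neither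
      of them contributes to the eigenvalue equation at the other arcs.\<close>
    have "\<mu> * x (r e) = (\<Sum>b | b \<in> A \<and> s b = t (r e) \<and> b \<noteq> r (r e). x b)"
      using eig re by blast
    also have "{b. b \<in> A \<and> s b = t (r e) \<and> b \<noteq> r (r e)} = {}"
      using uniq tr[OF e(1)] e re by (metis (mono_tags, lifting) Collect_empty_eq)
    finally have x_re: "x (r e) = 0"
      using mu by simp
    have eig': "\<mu> * x a = (\<Sum>b | b \<in> ?A \<and> s b = t a \<and> b \<noteq> r a. x b)"
      if a: "a \<in> A" "a \<noteq> r e" for a
    proof -
      have "t a \<noteq> v"
        using uniq_t a by blast
      have "\<mu> * x a = (\<Sum>b | b \<in> A \<and> s b = t a \<and> b \<noteq> r a. x b)"
        using eig a by blast
      also have "\<dots> = (\<Sum>b | b \<in> ?A \<and> s b = t a \<and> b \<noteq> r a. x b)"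
        by (intro sum.mono_neutral_right) (use fin x_re e \<open>t a \<noteq> v\<close> in auto)
      finally show ?thesis .
    qed
    \<comment> \<open>Two arcs and one vertex disappear, so the bound
      \<open>card A - 2 * card V + 1\<close> is the same for the smaller graph.\<close>
    have card_A: "card A = card ?A + 2"
    proof -
      have "card {e, r e} = 2"
        using re by auto
      moreover have "card ?A = card A - card {e, r e}"
        using fin e re by (intro card_Diff_subset) auto
      moreover have "card {e, r e} \<le> card A"
        using fin e re by (intro card_mono) auto
      ultimately show ?thesis
        by linarith
    qed
    have card_V: "card V = Suc (card ?V)"
      using card_Suc_Diff1[OF fin(2) v(1)] ..
    have "cmod \<mu> \<le> real (card ?A) - 2 * real (card ?V) + 1"
    proof (rule less.hyps)
      show "card ?V < card V"
        using card_V by simp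
      show "finite ?A" "finite ?V"
        using fin by auto
      show "r a \<in> ?A \<and> r (r a) = a \<and> r a \<noteq> a \<and> s (r a) = t a \<and> s a \<in> ?V" if "a \<in> ?A" for a
        using rev_in[OF that] that rev[of a] uniq[of a] by blast
      show "\<mu> * x a = (\<Sum>b | b \<in> ?A \<and> s b = t a \<and> b \<noteq> r a. x b)" if "a \<in> ?A" for a
        using eig'[of a] that by auto
      \<comment> \<open>Were \<open>x\<close> zero on all remaining arcs, the equation at
        \<open>e\<close>, which \<open>eig'\<close> also covers, would give \<open>x e = 0\<close>.
        Together with \<open>x_re\<close> this makes \<open>x\<close> vanish on all of
        \<open>A\<close>.\<close>
      show "\<exists>a\<in>?A. x a \<noteq> 0"
      proof (rule ccontr)
        assume "\<not> (\<exists>a\<in>?A. x a \<noteq> 0)"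
        hence zero: "x a = 0" if "a \<in> ?A" for a
          using that by blast
        have "\<mu> * x e = (\<Sum>b | b \<in> ?A \<and> s b = t e \<and> b \<noteq> r e. x b)"
          using eig'[of e] e re by auto
        also have "\<dots> = 0"
          using zero by (intro sum.neutral) auto
        finally have "x e = 0"
          using mu by simp
        thus False
          using a1 zero[of a1] x_re by auto
      qed
      \<comment> \<open>A closed set of the smaller graph that contains the neighbour
        \<open>t e\<close> of the leaf becomes closed in the old graph once \<open>v\<close> is
        added. One that avoids \<open>t e\<close> is already closed there, hence equal to
        \<open>V\<close>, although it omits \<open>v\<close>.\<close>
      show "U = ?V" if U: "U \<subseteq> ?V" "U \<noteq> {}" "\<And>a. \<lbrakk>a \<in> ?A; s a \<in> U\<rbrakk> \<Longrightarrow> t a \<in> U" for U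
      proof (cases "t e \<in> U")
        case True
        have "insert v U = V"
        proof (rule conn)
          fix a assume a: "a \<in> A" "s a \<in> insert v U"
          consider "a = e" | "a = r e" | "a \<in> ?A"
            using a by blast
          thus "t a \<in> insert v U"
          proof cases
            case 3
            hence "s a \<in> U"
              using a uniq[of a] by blast
            thus ?thesis
              using U(3)[OF 3] by blast
          qed (use True tr[OF e(1)] e in simp_all)
        qed (use U(1,2) v in auto)
        thus ?thesis
          using U(1) by auto
      next
        case False
        have "U = V"
        proof (rule conn)
          fix a assume a: "a \<in> A" "s a \<in> U"
          have "a \<noteq> e" "a \<noteq> r e"
            using a U(1) e re False by auto
          thus "t a \<in> U"
            using a U(3) by blast
        qed (use U(1,2) in auto)
        thus ?thesis
          using U(1) v by auto
      qed
    qed (use mu in auto)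
    thus ?thesis
      using card_A card_V by linarith
  qed
qed

section \<open>Eigenvectors of adjacency matrices as functions on the vertices\<close>

lemma adjacency_matrix_enum:
  assumes "finite (pverts D)"
  obtains vs where "distinct vs" "set vs = pverts D"
    "adjacency_matrix D =
      mat (length vs) (length vs) (\<lambda>(i, j). of_bool ((vs ! i, vs ! j) \<in> parcs D))"
proof -
  define vs where "vs = (SOME vs. distinct vs \<and> set vs = pverts D)"
  have "\<exists>vs. distinct vs \<and> set vs = pverts D"
    using finite_distinct_list[OF assms] by blast
  hence "distinct vs \<and> set vs = pverts D"
    unfolding vs_def by (rule someI_ex)
  thus thesis
    using that[of vs] by (simp add: adjacency_matrix_def vs_def[symmetric] Let_def)
qed

text \<open>Eliminates the arbitrary enumeration inside \<open>adjacency_matrix\<close>: reindexing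
  along it turns a matrix row into a sum over the successors of a vertex. Both directions are used,
  one for the upper bound on the spectral radius and one for the bouquet.\<close>

lemma eigenvalue_adjacency_matrix_iff:
  assumes "finite (pverts D)"
  shows "eigenvalue (adjacency_matrix D) \<mu> \<longleftrightarrow>
    (\<exists>x. (\<exists>a\<in>pverts D. x a \<noteq> 0) \<and>
      (\<forall>a\<in>pverts D. \<mu> * x a = (\<Sum>b | b \<in> pverts D \<and> (a, b) \<in> parcs D. x b)))"
    (is "?L \<longleftrightarrow> (\<exists>x. ?nz x \<and> ?eq x)")
proof -
  obtain vs where vs: "distinct vs" "set vs = pverts D"
    and A: "adjacency_matrix D =
      mat (length vs) (length vs) (\<lambda>(i, j). of_bool ((vs ! i, vs ! j) \<in> parcs D))"
    using adjacency_matrix_enum[OF assms] .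
  define n where "n = length vs"
  have bij: "bij_betw (\<lambda>i. vs ! i) {..<n} (pverts D)"
    using vs by (intro bij_betw_nth) (auto simp: n_def)
  have row: "(adjacency_matrix D *\<^sub>v vec n (\<lambda>i. x (vs ! i))) $ i =
      (\<Sum>b | b \<in> pverts D \<and> (vs ! i, b) \<in> parcs D. x b)" if i: "i < n" for i x
  proof -
    have "(adjacency_matrix D *\<^sub>v vec n (\<lambda>i. x (vs ! i))) $ i =
        (\<Sum>j<n. of_bool ((vs ! i, vs ! j) \<in> parcs D) * x (vs ! j))"
      using i by (simp add: A n_def scalar_prod_def atLeast0LessThan)
    also have "\<dots> = (\<Sum>b\<in>pverts D. of_bool ((vs ! i, b) \<in> parcs D) * x b)"
      by (rule sum.reindex_bij_betw[OF bij])
    also have "\<dots> = (\<Sum>b | b \<in> pverts D \<and> (vs ! i, b) \<in> parcs D. x b)"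
      using assms by (intro sum.mono_neutral_cong_right) auto
    finally show ?thesis .
  qed
  have eigenvector_iff: "eigenvector (adjacency_matrix D) (vec n (\<lambda>i. x (vs ! i))) \<mu> \<longleftrightarrow>
      ?nz x \<and> ?eq x" for x
  proof -
    have all: "(\<forall>i<n. P (vs ! i)) \<longleftrightarrow> (\<forall>a\<in>pverts D. P a)" for P
      unfolding n_def vs(2)[symmetric] all_set_conv_all_nth ..
    have "vec n (\<lambda>i. x (vs ! i)) = 0\<^sub>v n \<longleftrightarrow> (\<forall>i<n. x (vs ! i) = 0)"
      by (auto simp: vec_eq_iff)
    moreover have "adjacency_matrix D *\<^sub>v vec n (\<lambda>i. x (vs ! i)) = \<mu> \<cdot>\<^sub>v vec n (\<lambda>i. x (vs ! i)) \<longleftrightarrow>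
        (\<forall>i<n. \<mu> * x (vs ! i) = (\<Sum>b | b \<in> pverts D \<and> (vs ! i, b) \<in> parcs D. x b))"
    proof -
      have "dim_vec (adjacency_matrix D *\<^sub>v vec n (\<lambda>i. x (vs ! i))) = n"
        by (simp add: A n_def)
      thus ?thesis
        unfolding vec_eq_iff by (auto simp: row simp del: index_mult_mat_vec)
    qed
    moreover have "dim_row (adjacency_matrix D) = n"
      by (simp add: A n_def)
    ultimately show ?thesis
      unfolding eigenvector_def using all[of "\<lambda>a. x a = 0"]
        all[of "\<lambda>a. \<mu> * x a = (\<Sum>b | b \<in> pverts D \<and> (a, b) \<in> parcs D. x b)"] by auto
  qed
  show ?thesis
  proof
    assume ?L
    then obtain v where v: "eigenvector (adjacency_matrix D) v \<mu>"
      unfolding eigenvalue_def by blast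
    hence "dim_vec v = n"
      by (simp add: eigenvector_def A n_def)
    \<comment> \<open>The inverse of the enumeration turns the given vector into a function on the
      vertices.\<close>
    define x where "x a = v $ the_inv_into {..<n} (\<lambda>i. vs ! i) a" for a
    have v_eq: "v = vec n (\<lambda>i. x (vs ! i))"
      using \<open>dim_vec v = n\<close> bij by (auto simp: x_def bij_betw_def the_inv_into_f_f)
    show "\<exists>x. ?nz x \<and> ?eq x"
      by (rule exI, rule eigenvector_iff[THEN iffD1, OF v[unfolded v_eq]])
  next
    assume "\<exists>x. ?nz x \<and> ?eq x"
    then obtain x where "?nz x \<and> ?eq x" ..
    thus ?L
      unfolding eigenvalue_def by (intro exI, rule eigenvector_iff[THEN iffD2])
  qed
qed

lemma adjacency_matrix_carrier:
  assumes "finite (pverts D)"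
  shows "adjacency_matrix D \<in> carrier_mat (card (pverts D)) (card (pverts D))"
  by (rule adjacency_matrix_enum[OF assms]) (simp flip: distinct_card)

section \<open>Spectral radius and order of connected graphs\<close>

text \<open>The involution \<open>arev\<close> has no fixed point among the arcs, so its orbits
  split them into pairs. In particular a whole-loop is one edge.\<close>

lemma card_undirected_edges:
  assumes "wf_lgraph T" and "finite (arcs (dgraph T))"
  shows "2 * card (undirected_edges T) = card (arcs (dgraph T))"
proof -
  interpret bidirected_digraph "dgraph T" "arev T"
    by (rule assms(1))
  have "card (\<Union> (undirected_edges T)) = (\<Sum>E\<in>undirected_edges T. card E)"
    by (rule card_Union_disjoint)
      (auto simp: undirected_edges_def pairwise_def disjnt_def arev_eq_iff)
  also have "\<dots> = (\<Sum>E\<in>undirected_edges T. 2)"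
    by (intro sum.cong refl) (auto simp: undirected_edges_def dest!: arev_neq)
  also have "\<Union> (undirected_edges T) = arcs (dgraph T)"
    by (auto simp: undirected_edges_def)
  finally show ?thesis
    by simp
qed

text \<open>Links the library's connectedness to the closed-set form of the eigenvalue bound.
  Applying closure to \<open>arev T a\<close> shows that no arc enters \<open>U\<close> from outside
  either, so \<open>U\<close> absorbs everything reachable in the symmetric closure.\<close>

lemma connected_closed_subset:
  assumes wf: "wf_lgraph T" and conn: "Digraph_Component.connected (dgraph T)"
    and U: "U \<subseteq> verts (dgraph T)" "U \<noteq> {}"
    and closed: "\<And>a. \<lbrakk>a \<in> arcs (dgraph T); tail (dgraph T) a \<in> U\<rbrakk> \<Longrightarrow> head (dgraph T) a \<in> U"
  shows "U = verts (dgraph T)"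
proof
  interpret bidirected_digraph "dgraph T" "arev T"
    by (rule wf)
  interpret S: pair_wf_digraph "mk_symmetric (dgraph T)"
    by (rule wellformed_mk_symmetric)
  have step: "w \<in> U" if "(u, w) \<in> parcs (mk_symmetric (dgraph T))" "u \<in> U" for u w
  proof -
    obtain a where a: "a \<in> arcs (dgraph T)"
      and uw: "u = tail (dgraph T) a \<and> w = head (dgraph T) a \<or>
        u = head (dgraph T) a \<and> w = tail (dgraph T) a"
      using \<open>(u, w) \<in> _\<close> by (auto simp: parcs_mk_symmetric)
    thus ?thesis
      using closed[of a] closed[of "arev T a"] \<open>u \<in> U\<close> by auto
  qed
  obtain u where "u \<in> U"
    using U by blast
  show "verts (dgraph T) \<subseteq> U"
  proof
    fix w assume "w \<in> verts (dgraph T)"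
    hence "u \<rightarrow>\<^sup>*\<^bsub>mk_symmetric (dgraph T)\<^esub> w"
      using conn U(1) \<open>u \<in> U\<close> by (auto simp: Digraph_Component.connected_def strongly_connected_def)
    thus "w \<in> U"
      by (induction rule: S.reachable_induct) (use \<open>u \<in> U\<close> step in auto)
  qed
qed (rule U(1))

text \<open>Positivity supplies an eigenvalue that is not 0. It excludes trees, whose order is -1
  and whose \<open>lambda_irr\<close> is 0, above the value -1 of the right-hand side.\<close>

lemma lambda_irr_le_order:
  assumes wf: "wf_lgraph T" and conn: "Digraph_Component.connected (dgraph T)"
    and fin: "finite (verts (dgraph T))" "finite (arcs (dgraph T))"
    and pos: "lambda_irr T > 0"
  shows "lambda_irr T \<le> 2 * real_of_int (graph_order T) + 1"
proof -
  interpret bidirected_digraph "dgraph T" "arev T"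
    by (rule wf)
  have nonempty: "arcs (dgraph T) \<noteq> {}" and
    lam: "lambda_irr T = spectral_radius (adjacency_matrix (irr_graph T))"
    using pos by (auto simp: lambda_irr_def split: if_splits)
  have fin': "finite (pverts (irr_graph T))"
    using fin by (simp add: irr_graph_def)
  \<comment> \<open>The spectral radius is attained by an eigenvalue because the matrix has positive
    dimension, by \<open>nonempty\<close>.\<close>
  have "lambda_irr T \<in> cmod ` spectrum (adjacency_matrix (irr_graph T))"
    unfolding lam
    by (rule spectral_radius_mem_max(1)[OF adjacency_matrix_carrier[OF fin']])
      (use nonempty fin in \<open>simp add: irr_graph_def card_gt_0_iff\<close>)
  then obtain \<mu> where mu: "lambda_irr T = cmod \<mu>"
    and ev: "eigenvalue (adjacency_matrix (irr_graph T)) \<mu>"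
    by (auto simp: spectrum_def)
  then obtain x where nz: "\<exists>a\<in>arcs (dgraph T). x a \<noteq> 0"
    and eq: "\<And>a. a \<in> arcs (dgraph T) \<Longrightarrow>
      \<mu> * x a = (\<Sum>b | b \<in> pverts (irr_graph T) \<and> (a, b) \<in> parcs (irr_graph T). x b)"
    unfolding eigenvalue_adjacency_matrix_iff[OF fin'] by (auto simp: irr_graph_def)
  have "cmod \<mu> \<le> real (card (arcs (dgraph T))) - 2 * real (card (verts (dgraph T))) + 1"
  proof (rule nonbacktracking_eigenvalue_le[OF fin(2,1)])
    fix U assume "U \<subseteq> verts (dgraph T)" "U \<noteq> {}"
      "\<And>a. \<lbrakk>a \<in> arcs (dgraph T); tail (dgraph T) a \<in> U\<rbrakk> \<Longrightarrow> head (dgraph T) a \<in> U"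
    thus "U = verts (dgraph T)"
      by (rule connected_closed_subset[OF wf conn])
  next
    fix a assume a: "a \<in> arcs (dgraph T)"
    have "{b. b \<in> pverts (irr_graph T) \<and> (a, b) \<in> parcs (irr_graph T)} =
        {b. b \<in> arcs (dgraph T) \<and> tail (dgraph T) b = head (dgraph T) a \<and> b \<noteq> arev T a}"
      using a by (auto simp: irr_graph_def)
    thus "\<mu> * x a = (\<Sum>b | b \<in> arcs (dgraph T) \<and> tail (dgraph T) b = head (dgraph T) a \<and>
        b \<noteq> arev T a. x b)"
      using eq[OF a] by simp
  qed (use nz mu pos in \<open>auto simp: arev_neq\<close>)
  moreover have "real (card (arcs (dgraph T))) = 2 * real (card (undirected_edges T))"
    using card_undirected_edges[OF wf fin(2)] by linarith
  ultimately show ?thesis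
    using mu by (simp add: graph_order_def)
qed

section \<open>Lower bound for the order of supercritical tangles\<close>

text \<open>Finiteness is inherited from the permutation graph along the injections of the
  occurrence.\<close>

lemma tangle_finite:
  assumes "tangle d T"
  shows "finite (verts (dgraph T))" "finite (arcs (dgraph T))"
proof -
  obtain n \<pi> f g where hom: "lgraph_hom f g T (perm_graph n d \<pi>)"
    and inj: "inj_on f (verts (dgraph T))" "inj_on g (arcs (dgraph T))"
    using assms by (auto simp: tangle_def set_random_perm_graph occurs_in_def)
  have "f ` verts (dgraph T) \<subseteq> {1..n}" "g ` arcs (dgraph T) \<subseteq> perm_arcs n d"
    using hom by (auto simp: lgraph_hom_def perm_graph_def)
  moreover have "finite (perm_arcs n d)"
    by (simp add: perm_arcs_def)
  ultimately show "finite (verts (dgraph T))" "finite (arcs (dgraph T))"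
    using inj by (metis finite_atLeastAtMost finite_subset inj_on_finite)
      (use inj \<open>finite (perm_arcs n d)\<close> \<open>g ` _ \<subseteq> _\<close> in \<open>metis inj_on_finite\<close>)
qed

text \<open>The order is an integer, so the lower bound obtained from
  \<open>lambda_irr_le_order\<close> may be rounded up, which produces the ceiling in
  \<open>tau_fund\<close>.\<close>

lemma supercritical_tangle_order_ge:
  assumes "supercritical_tangle d T" and "d \<ge> 2"
  shows "graph_order T \<ge> tau_fund d"
proof -
  have T: "tangle d T" and lam: "lambda_irr T \<ge> sqrt (real d - 1)"
    using assms by (auto simp: supercritical_tangle_def)
  have "sqrt (real d - 1) > 0"
    using assms(2) by simp
  hence "lambda_irr T > 0"
    using lam by linarith
  hence "lambda_irr T \<le> 2 * real_of_int (graph_order T) + 1"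
    using T tangle_finite[OF T] by (intro lambda_irr_le_order) (auto simp: tangle_def)
  hence "(sqrt (real d - 1) + 1) / 2 \<le> real_of_int (graph_order T + 1)"
    using lam by simp
  hence "\<lceil>(sqrt (real d - 1) + 1) / 2\<rceil> \<le> graph_order T + 1"
    by (rule ceiling_le)
  thus ?thesis
    by (simp add: tau_fund_def)
qed

section \<open>The bouquet of whole-loops as extremal tangle\<close>

text \<open>The whole-loop with label \<open>Perm (j + 1)\<close> consists of the arcs \<open>2 * j\<close> and \<open>2 * j + 1\<close>.\<close>
definition bouquet :: "nat \<Rightarrow> (nat, nat) lgraph" where
  "bouquet m =
    \<lparr> dgraph = \<lparr> verts = {0}, arcs = {..<2 * m}, tail = (\<lambda>_. 0), head = (\<lambda>_. 0) \<rparr>,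
      arev = (\<lambda>e. if e < 2 * m then if even e then e + 1 else e - 1 else e),
      label = (\<lambda>e. if even e then Perm (e div 2 + 1) else PermInv (e div 2 + 1)) \<rparr>"

lemma wf_bouquet: "wf_lgraph (bouquet m)"
proof unfold_locales
  fix a
  show "a \<in> arcs (dgraph (bouquet m)) \<longleftrightarrow> arev (bouquet m) a \<noteq> a"
    by (auto simp: bouquet_def elim: oddE)
  show "arev (bouquet m) (arev (bouquet m) a) = a" if "a \<in> arcs (dgraph (bouquet m))"
    using that by (auto simp: bouquet_def elim!: oddE evenE)
qed (auto simp: bouquet_def)

text \<open>For \<open>n = 1\<close> all permutations are the identity, and the permutation graph is
  itself a bouquet of \<open>d div 2\<close> whole-loops with distinct labels. Any \<open>m\<close>
  of them form a subgraph.\<close>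

lemma tangle_bouquet:
  assumes "m \<le> d div 2"
  shows "tangle d (bouquet m)"
  unfolding tangle_def
proof (intro conjI)
  show "Digraph_Component.connected (dgraph (bouquet m))"
  proof -
    interpret bidirected_digraph "dgraph (bouquet m)" "arev (bouquet m)"
      by (rule wf_bouquet)
    interpret S: pair_wf_digraph "mk_symmetric (dgraph (bouquet m))"
      by (rule wellformed_mk_symmetric)
    have "verts (dgraph (bouquet m)) = {0}"
      by (simp add: bouquet_def)
    thus ?thesis
      unfolding Digraph_Component.connected_def strongly_connected_def
      using S.reachable_refl[of 0] by simp
  qed
  let ?f = "\<lambda>_. 1 :: nat" and ?g = "\<lambda>e. (label (bouquet m) e, 1 :: nat)"
  let ?G = "perm_graph 1 d (\<lambda>_. id)"
  have lt: "Suc (e div 2) \<in> {1..d div 2}" if "e < 2 * m" for e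
    using that assms by auto
  have label: "label (bouquet m) e \<in> Perm ` {1..d div 2} \<union> PermInv ` {1..d div 2}"
    if "e < 2 * m" for e
    using lt[OF that] by (simp add: bouquet_def image_iff)
  have "?G \<in> set_pmf (random_perm_graph 1 d)"
    by (auto simp: set_random_perm_graph PiE_dflt_def permutes_id)
  moreover have "lgraph_hom ?f ?g (bouquet m) ?G"
    unfolding lgraph_hom_def
  proof (intro conjI ballI)
    show "?g ` arcs (dgraph (bouquet m)) \<subseteq> arcs (dgraph ?G)"
      using label by (auto simp: perm_graph_def perm_arcs_def bouquet_def)
    fix e assume e: "e \<in> arcs (dgraph (bouquet m))"
    show "arev ?G (?g e) = ?g (arev (bouquet m) e)"
      using e label[of e] by (auto simp: perm_graph_def perm_arcs_def bouquet_def elim!: oddE evenE)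
  qed (auto simp: perm_graph_def bouquet_def)
  moreover have "inj_on ?g (arcs (dgraph (bouquet m)))"
    \<comment> \<open>The label determines the arc: its index gives the loop and its constructor the
      direction.\<close>
    by (rule inj_on_inverseI[of _ "\<lambda>(l, i). case l of Perm j \<Rightarrow> 2 * (j - 1) | PermInv j \<Rightarrow> 2 * (j - 1) + 1"])
      (simp add: bouquet_def)
  ultimately show "\<exists>n. \<exists>G \<in> set_pmf (random_perm_graph n d). occurs_in (bouquet m) G"
    unfolding occurs_in_def by (auto simp: bouquet_def)
qed (rule wf_bouquet)

lemma graph_order_bouquet: "graph_order (bouquet m) = int m - 1"
  using card_undirected_edges[OF wf_bouquet, of m] by (simp add: graph_order_def bouquet_def)

text \<open>On a single vertex each arc is followed by every arc except its reverse, so the constant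
  function 1 is an eigenvector. Its eigenvalue bounds the spectral radius from below.\<close>

lemma lambda_irr_bouquet_ge:
  assumes "m > 0"
  shows "lambda_irr (bouquet m) \<ge> 2 * real m - 1"
proof -
  interpret bidirected_digraph "dgraph (bouquet m)" "arev (bouquet m)"
    by (rule wf_bouquet)
  let ?D = "irr_graph (bouquet m)"
  have pverts: "pverts ?D = {..<2 * m}" and arcs: "arcs (dgraph (bouquet m)) = {..<2 * m}"
    by (simp_all add: irr_graph_def bouquet_def)
  have "complex_of_real (2 * real m - 1) = (\<Sum>b | b \<in> pverts ?D \<and> (a, b) \<in> parcs ?D. 1)"
    if "a \<in> pverts ?D" for a
  proof -
    have "{b. b \<in> pverts ?D \<and> (a, b) \<in> parcs ?D} = {..<2 * m} - {arev (bouquet m) a}"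
      using that by (auto simp: irr_graph_def bouquet_def)
    moreover have "arev (bouquet m) a \<in> {..<2 * m}"
      using that arev_in_arcs[of a] by (simp add: pverts arcs)
    ultimately show ?thesis
      using assms by (simp add: of_nat_diff)
  qed
  moreover have "0 \<in> pverts ?D"
    using assms by (simp add: pverts)
  ultimately have "eigenvalue (adjacency_matrix ?D) (complex_of_real (2 * real m - 1))"
    by (subst eigenvalue_adjacency_matrix_iff) (simp add: pverts, intro exI[of _ "\<lambda>_. 1"], auto)
  hence "cmod (complex_of_real (2 * real m - 1)) \<in> cmod ` spectrum (adjacency_matrix ?D)"
    by (simp add: spectrum_def)
  hence "cmod (complex_of_real (2 * real m - 1)) \<le> spectral_radius (adjacency_matrix ?D)"
    by (intro spectral_radius_mem_max(2)[OF adjacency_matrix_carrier]) (use assms in \<open>auto simp: pverts\<close>)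
  thus ?thesis
    using assms unfolding norm_of_real by (auto simp: lambda_irr_def arcs lessThan_empty_iff)
qed

text \<open>The witness lives on natural numbers, while the lower bound is polymorphic in the vertex
  and arc types. Taking both types to be \<open>nat\<close> shows that the value is a
  minimum.\<close>

theorem theorem6p8:
  fixes d :: nat
  assumes "even d" and "d \<ge> 4"
  shows "(\<exists>T :: (nat, nat) lgraph. supercritical_tangle d T \<and> graph_order T = tau_fund d) \<and>
    (\<forall>T :: ('v, 'e) lgraph. supercritical_tangle d T \<longrightarrow> graph_order T \<ge> tau_fund d)"
proof
  \<comment> \<open>The least number of loops with
    \<open>2 * m - 1 \<ge> sqrt (real d - 1)\<close>.\<close>
  define m where "m = nat \<lceil>(sqrt (real d - 1) + 1) / 2\<rceil>"
  have pos: "sqrt (real d - 1) > 0"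
    using assms(2) by simp
  hence "(sqrt (real d - 1) + 1) / 2 > 0"
    by (intro divide_pos_pos add_pos_pos) auto
  hence "\<lceil>(sqrt (real d - 1) + 1) / 2\<rceil> > 0"
    by simp
  hence m_pos: "m > 0" and int_m: "int m = \<lceil>(sqrt (real d - 1) + 1) / 2\<rceil>"
    by (simp_all add: m_def)
  \<comment> \<open>Only \<open>d div 2\<close> labels are available for the loops. As
    \<open>d\<close> is even, \<open>d / 2\<close> is an integer, so the upper bound
    \<open>d / 2\<close> survives the ceiling in \<open>m\<close>.\<close>
  have "sqrt (real d - 1) \<le> real d - 1"
    using assms(2) by (intro real_le_lsqrt) (auto simp: self_le_power)
  hence "(sqrt (real d - 1) + 1) / 2 \<le> real_of_int (int (d div 2))"
    using assms(1) by (simp add: real_of_nat_div)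
  hence "m \<le> d div 2"
    using ceiling_le int_m by (metis of_nat_le_iff)
  moreover have "sqrt (real d - 1) \<le> 2 * real m - 1"
    using le_of_int_ceiling[of "(sqrt (real d - 1) + 1) / 2"] unfolding int_m[symmetric] by simp
  ultimately have "supercritical_tangle d (bouquet m)"
    using tangle_bouquet lambda_irr_bouquet_ge[OF m_pos] by (fastforce simp: supercritical_tangle_def)
  moreover have "graph_order (bouquet m) = tau_fund d"
    by (simp add: graph_order_bouquet int_m tau_fund_def)
  ultimately show "\<exists>T :: (nat, nat) lgraph. supercritical_tangle d T \<and> graph_order T = tau_fund d"
    by blast
  show "\<forall>T :: ('v, 'e) lgraph. supercritical_tangle d T \<longrightarrow> graph_order T \<ge> tau_fund d"
    using supercritical_tangle_order_ge assms(2) by fastforce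
qed

end
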